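(* $K_n'$ has geometric antithickness $2$.
   Context: All graphs are undirected, finite and simple. $K_n$ is the complete graph on $n$ vertices, and $K_n'$ is the graph obtained from $K_n$ by subdividing each edge exactly once. A geometric drawing of a graph maps vertices to distinct points in the plane and edges to straight line segments between their end-vertices, such that no edge passes through a vertex other than its own end-vertices and edges cross properly. A set of edges in a drawing is a thrackle if every pair of distinct edges in it intersect exactly once (either at a common end-vertex or at a crossing point). The antithickness of a drawing is the minimum positive integer $k$ such that its edges can be partitioned into $k$ thrackles. The geometric antithickness of a graph $G$ is the minimum positive integer $k$ such that $G$ has a geometric drawing with antithickness $k$.
   Formalization: The claim is stated for n ≥ 3, since K_1' (no edges) and K_2' (a path with two edges, a single thrackle) have geometric antithickness 1, so the statement fails for them. *)

theory Defs
  imports "HOL-Analysis.Analysis"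
begin

text \<open>A graph is a pair of a vertex set and a set of edges, each edge being the
  two-element set of its end-vertices.\<close>

type_synonym 'a graph = "'a set \<times> 'a set set"

abbreviation vertices :: "'a graph \<Rightarrow> 'a set" where
  "vertices \<equiv> fst"

abbreviation edges :: "'a graph \<Rightarrow> 'a set set" where
  "edges \<equiv> snd"

definition finite_simple_graph :: "'a graph \<Rightarrow> bool" where
  "finite_simple_graph G \<longleftrightarrow>
     finite (vertices G) \<and> (\<forall>e \<in> edges G. e \<subseteq> vertices G \<and> card e = 2)"

definition complete_graph :: "nat \<Rightarrow> nat graph" where
  "complete_graph n = ({..<n}, {e. e \<subseteq> {..<n} \<and> card e = 2})"

text \<open>Every edge is subdivided exactly once: the old vertices are tagged with
  \<open>Inl\<close>, and the division vertex of an edge \<open>e\<close> is \<open>Inr e\<close>.\<close>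

definition subdivision :: "'a graph \<Rightarrow> ('a + 'a set) graph" where
  "subdivision G =
     (Inl ` vertices G \<union> Inr ` edges G, {{Inl v, Inr e} | v e. e \<in> edges G \<and> v \<in> e})"

lemma finite_simple_graph_complete_graph: "finite_simple_graph (complete_graph n)"
  by (auto simp: finite_simple_graph_def complete_graph_def)

lemma finite_simple_graph_subdivision:
  assumes "finite_simple_graph G"
  shows "finite_simple_graph (subdivision G)"
proof -
  have "edges G \<subseteq> Pow (vertices G)"
    using assms by (auto simp: finite_simple_graph_def)
  then have "finite (edges G)"
    using assms finite_subset by (auto simp: finite_simple_graph_def)
  then show ?thesis
    using assms by (auto simp: finite_simple_graph_def subdivision_def)
qed

type_synonym plane = "real \<times> real"

text \<open>For an edge \<open>e = {u, v}\<close> this is the closed segment from \<open>p u\<close> to \<open>p v\<close>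
  (see \<open>segment_convex_hull\<close>), and its relative interior is the open one.\<close>

definition edge_segment :: "('a \<Rightarrow> plane) \<Rightarrow> 'a set \<Rightarrow> plane set" where
  "edge_segment p e = convex hull (p ` e)"

text \<open>Two segments cross properly at a common interior point precisely when they do
  not lie on a common line.\<close>

definition cross_properly_at :: "('a \<Rightarrow> plane) \<Rightarrow> 'a set \<Rightarrow> 'a set \<Rightarrow> plane \<Rightarrow> bool" where
  "cross_properly_at p e f x \<longleftrightarrow>
     x \<in> rel_interior (edge_segment p e) \<and> x \<in> rel_interior (edge_segment p f) \<and>
     \<not> collinear (p ` (e \<union> f))"

definition geometric_drawing :: "'a graph \<Rightarrow> ('a \<Rightarrow> plane) \<Rightarrow> bool" where
  "geometric_drawing G p \<longleftrightarrow>
     inj_on p (vertices G) \<and>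
     (\<forall>e \<in> edges G. \<forall>v \<in> vertices G. v \<notin> e \<longrightarrow> p v \<notin> edge_segment p e) \<and>
     (\<forall>e \<in> edges G. \<forall>f \<in> edges G. e \<noteq> f \<longrightarrow>
        (\<forall>x \<in> rel_interior (edge_segment p e) \<inter> rel_interior (edge_segment p f).
           cross_properly_at p e f x))"

definition thrackle :: "('a \<Rightarrow> plane) \<Rightarrow> 'a set set \<Rightarrow> bool" where
  "thrackle p T \<longleftrightarrow>
     (\<forall>e \<in> T. \<forall>f \<in> T. e \<noteq> f \<longrightarrow>
        (\<exists>x. edge_segment p e \<inter> edge_segment p f = {x} \<and>
             (x \<in> p ` (e \<inter> f) \<or> cross_properly_at p e f x)))"

text \<open>The partition is given by a colouring of the edges. Parts may be empty, so that an
  edgeless graph is partitioned into one thrackle; this does not affect the minimum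
  otherwise.\<close>

definition drawing_antithickness :: "'a graph \<Rightarrow> ('a \<Rightarrow> plane) \<Rightarrow> nat" where
  "drawing_antithickness G p =
     (LEAST k. k > 0 \<and> (\<exists>c. (\<forall>e \<in> edges G. c e < k) \<and>
                              (\<forall>i < k. thrackle p {e \<in> edges G. c e = i})))"

definition geometric_antithickness :: "'a graph \<Rightarrow> nat" where
  "geometric_antithickness G =
     (LEAST k. k > 0 \<and> (\<exists>p. geometric_drawing G p \<and> drawing_antithickness G p = k))"

end

theory Submission imports Defs begin

text \<open>
  One thrackle is not enough. For \<open>n \<ge> 3\<close> the graph contains a hexagon, and a hexagon
  \<open>a0 \<dots> a5\<close> has no straight-line drawing in which any two disjoint edges cross. Indeed, look
  at the line through \<open>a0\<close> and \<open>a1\<close>. The three edges of the path from \<open>a2\<close> to \<open>a5\<close> must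
  each cross the edge \<open>a0 a1\<close>, so the vertices of that path alternate between the sides of this
  line, and \<open>a2\<close> and \<open>a5\<close> end up on opposite sides. But the edges \<open>a1 a2\<close> and
  \<open>a0 a5\<close> start on the line and meet off it, so \<open>a2\<close> and \<open>a5\<close> lie on the same side
  (\<open>hexagon_not_thrackle\<close>).

  Two thrackles are enough. Colour the two edges at the division vertex of \<open>{i, j}\<close>, \<open>i < j\<close>,
  according to whether they lead to \<open>i\<close> or to \<open>j\<close>. Each colour class is a union of stars
  centred at original vertices. Place the original vertices at points \<open>(t\<^sub>x, 0)\<close> with \<open>t\<^sub>x\<close>
  increasing and the division vertices at \<open>(f / g, 1 / g)\<close> with \<open>g > 0\<close>. A division vertex
  then corresponds to the affine function \<open>t \<mapsto> f - g t\<close>, and by clearing denominators one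
  sees that, viewed from \<open>(t, 0)\<close>, one division vertex lies to the right of another exactly when
  its function has the greater value at \<open>t\<close>. Consequently, for \<open>x < y\<close>, an edge from
  \<open>t\<^sub>x\<close> crosses an edge from \<open>t\<^sub>y\<close> if and only if the function of the first division
  vertex exceeds that of the second at both \<open>t\<^sub>x\<close> and \<open>t\<^sub>y\<close>.

  It remains to choose functions such that those of \<open>{i, j}\<close> and \<open>{k, l}\<close> are in decreasing
  order at \<open>t\<^sub>i\<close> and \<open>t\<^sub>k\<close> whenever \<open>i < k\<close>, and at \<open>t\<^sub>j\<close> and \<open>t\<^sub>l\<close>
  whenever \<open>j < l\<close>. With \<open>f = - b i\<close> and \<open>g = a j\<close> for increasing positive \<open>a\<close> and
  \<open>b\<close> the difference is \<open>(b k - b i) + (a l - a j) t\<close>, which is as desired for \<open>t > 0\<close> if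
  both pairs of ends are in the same order. The case that matters is that of nested pairs
  \<open>i < k < l < j\<close>, where the difference has to change sign between \<open>t\<^sub>k\<close> and \<open>t\<^sub>l\<close>, that
  is, \<open>(b k - b i) / (a j - a l)\<close> has to lie between them. With \<open>b i = 2 ^ i\<close> and
  \<open>a j = 2 - 2 ^ (-j)\<close> this quotient is \<open>2 ^ (k + l)\<close> up to a factor of at most \<open>2\<close> either way,
  so \<open>t\<^sub>x = 4 ^ x\<close> does the job (\<open>gap_pos_if_mins_less\<close>, \<open>gap_pos_if_maxs_less\<close>).
\<close>

section \<open>Orientation and crossing of segments\<close>

text \<open>Twice the signed area of the triangle \<open>a b r\<close>: positive if \<open>r\<close> lies to the left of
  the line directed from \<open>a\<close> to \<open>b\<close>.\<close>

definition side :: "plane \<Rightarrow> plane \<Rightarrow> plane \<Rightarrow> real" where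
  "side a b r = (fst b - fst a) * (snd r - snd a) - (snd b - snd a) * (fst r - fst a)"

lemma side_endpoints [simp]: "side a b a = 0" "side a b b = 0"
  by (simp_all add: side_def algebra_simps)

lemma side_affine:
  "side a b ((1 - t) *\<^sub>R r + t *\<^sub>R s) = (1 - t) * side a b r + t * side a b s"
  by (simp add: side_def algebra_simps)

lemma side_eq_0_on_segment: "x \<in> closed_segment a b \<Longrightarrow> side a b x = 0"
  by (auto simp: in_segment side_affine)

lemma side_eq_0_imp_on_line:
  assumes "a \<noteq> b" "side a b r = 0"
  shows "\<exists>c. r = a + c *\<^sub>R (b - a)"
proof (cases "fst b = fst a")
  case True
  then have "snd b \<noteq> snd a"
    using assms(1) by (metis prod_eqI)
  then have "r = a + ((snd r - snd a) / (snd b - snd a)) *\<^sub>R (b - a)"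
    using assms(2) True by (intro prod_eqI) (simp_all add: side_def)
  then show ?thesis ..
next
  case False
  then have "snd r - snd a = (fst r - fst a) / (fst b - fst a) * (snd b - snd a)"
    using assms(2) by (simp add: side_def nonzero_eq_divide_eq mult.commute)
  with False have "r = a + ((fst r - fst a) / (fst b - fst a)) *\<^sub>R (b - a)"
    by (intro prod_eqI) simp_all
  then show ?thesis ..
qed

lemma collinear_if_side_eq_0:
  assumes "a \<noteq> b" "\<And>r. r \<in> S \<Longrightarrow> side a b r = 0"
  shows "collinear S"
  unfolding collinear_def
proof (intro exI[of _ "b - a"] ballI)
  fix x y assume "x \<in> S" "y \<in> S"
  then obtain c d where "x = a + c *\<^sub>R (b - a)" "y = a + d *\<^sub>R (b - a)"
    using assms side_eq_0_imp_on_line by metis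
  then have "x - y = (c - d) *\<^sub>R (b - a)"
    by (simp add: scaleR_left_diff_distrib)
  then show "\<exists>c. x - y = c *\<^sub>R (b - a)" ..
qed

lemma collinear_imp_side_eq_0:
  assumes "collinear S" "a \<in> S" "b \<in> S" "r \<in> S"
  shows "side a b r = 0"
proof -
  obtain u where u: "\<forall>x \<in> S. \<forall>y \<in> S. \<exists>c. x - y = c *\<^sub>R u"
    using assms(1) collinear_def by blast
  obtain c d where "b - a = c *\<^sub>R u" "r - a = d *\<^sub>R u"
    using u assms by meson
  then have "fst b - fst a = c * fst u" "snd b - snd a = c * snd u"
    "fst r - fst a = d * fst u" "snd r - snd a = d * snd u"
    by (metis fst_diff snd_diff fst_scaleR snd_scaleR real_scaleR_def)+
  then show ?thesis by (simp add: side_def)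
qed

lemma edge_segment_pair: "edge_segment p {u, v} = closed_segment (p u) (p v)"
  by (simp add: edge_segment_def segment_convex_hull)

text \<open>The crossing point is a proper convex combination of the ends of the second edge, and
  \<^term>\<open>side\<close> is affine and vanishes there. So either the values at the two ends have opposite
  signs, or both are zero and the four points are collinear.\<close>

lemma opposite_sides_if_cross_properly:
  assumes "cross_properly_at p {a, b} {r, s} x" "p a \<noteq> p b" "p r \<noteq> p s"
  shows "side (p a) (p b) (p r) * side (p a) (p b) (p s) < 0"
proof -
  let ?F = "side (p a) (p b)"
  from assms have x: "x \<in> open_segment (p a) (p b)" "x \<in> open_segment (p r) (p s)"
    and nc: "\<not> collinear (p ` ({a, b} \<union> {r, s}))"
    by (auto simp: cross_properly_at_def edge_segment_pair rel_interior_closed_segment)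
  obtain t where t: "0 < t" "t < 1" "x = (1 - t) *\<^sub>R p r + t *\<^sub>R p s"
    using x(2) by (auto simp: in_segment)
  have "?F x = 0"
    using x(1) by (simp add: open_segment_def side_eq_0_on_segment)
  then have eq: "(1 - t) * ?F (p r) = - (t * ?F (p s))"
    using t(3) by (simp add: side_affine)
  have "?F (p s) \<noteq> 0"
  proof
    assume "?F (p s) = 0"
    with eq t have "?F (p r) = 0" by simp
    with \<open>?F (p s) = 0\<close> have "collinear (p ` ({a, b} \<union> {r, s}))"
      by (intro collinear_if_side_eq_0[OF assms(2)]) auto
    with nc show False by simp
  qed
  then have "0 < t * (?F (p s))\<^sup>2"
    using t by simp
  moreover have "(1 - t) * (?F (p r) * ?F (p s)) = - (t * (?F (p s))\<^sup>2)"
    using eq by (metis (no_types) mult.assoc mult_minus_left power2_eq_square)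
  ultimately have "(1 - t) * (?F (p r) * ?F (p s)) < 0" by simp
  then show ?thesis
    using t by (simp add: mult_less_0_iff)
qed

lemma closed_segments_common_endpoint:
  assumes "side a b c \<noteq> 0"
  shows "closed_segment a b \<inter> closed_segment a c = {a}"
proof -
  have "x = a" if x: "x \<in> closed_segment a b" "x \<in> closed_segment a c" for x
  proof -
    obtain t where t: "x = (1 - t) *\<^sub>R a + t *\<^sub>R c"
      using x(2) by (auto simp: in_segment)
    then have "t * side a b c = 0"
      using side_eq_0_on_segment[OF x(1)] by (simp add: side_affine)
    with assms t show ?thesis by simp
  qed
  then show ?thesis by auto
qed

lemma segments_cross_if_opposite_sides:
  assumes "side a b c * side a b d < 0" "side c d a * side c d b < 0"
  shows "\<exists>x. closed_segment a b \<inter> closed_segment c d = {x} \<and>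
             x \<in> open_segment a b \<and> x \<in> open_segment c d"
proof -
  let ?C = "side a b c" and ?D = "side a b d" and ?A = "side c d a" and ?B = "side c d b"
  have ne: "a \<noteq> b" "c \<noteq> d"
    using assms by (auto simp: side_def)
  \<comment> \<open>The parameters at which the affine functions \<open>side a b\<close> and \<open>side c d\<close> vanish on the
    other segment.\<close>
  define t where "t = ?C / (?C - ?D)"
  define s where "s = ?A / (?A - ?B)"
  have t: "0 < t" "t < 1" and s: "0 < s" "s < 1" and CD: "?C - ?D \<noteq> 0"
    and AB: "?A - ?B \<noteq> 0"
    using assms by (auto simp: t_def s_def mult_less_0_iff field_simps)
  define x where "x = (1 - t) *\<^sub>R c + t *\<^sub>R d"
  \<comment> \<open>Both differences are, up to sign, the determinant of the two direction vectors; multiplying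
    by it avoids divisions when the two candidate points are compared.\<close>
  have CA: "?A - ?B = - (?C - ?D)"
    by (simp add: side_def algebra_simps)
  have tC: "t * (?C - ?D) = ?C" and sA: "s * (?A - ?B) = ?A"
    using CD AB by (simp_all add: t_def s_def)
  have s': "s * (?C - ?D) = - ?A"
    using sA CA by (metis minus_minus mult_minus_right)
  have "x = (1 - s) *\<^sub>R a + s *\<^sub>R b"
  proof (rule prod_eqI)
    have "(?C - ?D) * fst x = (?C - ?D) * fst c + (t * (?C - ?D)) * (fst d - fst c)"
      by (simp add: x_def algebra_simps)
    also have "\<dots> = (?C - ?D) * fst a + (s * (?C - ?D)) * (fst b - fst a)"
      unfolding tC s' by (simp add: side_def algebra_simps)
    also have "\<dots> = (?C - ?D) * fst ((1 - s) *\<^sub>R a + s *\<^sub>R b)"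
      by (simp add: algebra_simps)
    finally show "fst x = fst ((1 - s) *\<^sub>R a + s *\<^sub>R b)"
      using CD by (metis mult_cancel_left)
    have "(?C - ?D) * snd x = (?C - ?D) * snd c + (t * (?C - ?D)) * (snd d - snd c)"
      by (simp add: x_def algebra_simps)
    also have "\<dots> = (?C - ?D) * snd a + (s * (?C - ?D)) * (snd b - snd a)"
      unfolding tC s' by (simp add: side_def algebra_simps)
    also have "\<dots> = (?C - ?D) * snd ((1 - s) *\<^sub>R a + s *\<^sub>R b)"
      by (simp add: algebra_simps)
    finally show "snd x = snd ((1 - s) *\<^sub>R a + s *\<^sub>R b)"
      using CD by (metis mult_cancel_left)
  qed
  then have in_open: "x \<in> open_segment a b" "x \<in> open_segment c d"
    using ne s t unfolding in_segment x_def by blast+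
  have "y = x" if y: "y \<in> closed_segment a b" "y \<in> closed_segment c d" for y
  proof -
    obtain r where r: "y = (1 - r) *\<^sub>R c + r *\<^sub>R d"
      using y(2) by (auto simp: in_segment)
    have "(1 - r) * ?C + r * ?D = 0"
      using side_eq_0_on_segment[OF y(1)] r by (simp add: side_affine)
    then have "r * (?C - ?D) = ?C"
      by (simp add: algebra_simps)
    then have "r = t"
      using CD by (simp add: t_def field_simps)
    with r show ?thesis by (simp add: x_def)
  qed
  moreover have "x \<in> closed_segment a b" "x \<in> closed_segment c d"
    using in_open by (simp_all add: open_segment_def)
  ultimately show ?thesis
    using in_open by blast
qed

section \<open>Hexagons are not geometric thrackles\<close>

text \<open>A parity argument: three sign changes along \<open>a2, a3, a4, a5\<close> contradict the crossing of
  the two edges that leave the line through \<open>a0\<close> and \<open>a1\<close>.\<close>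

lemma hexagon_not_thrackle:
  assumes dist: "distinct [a0, a1, a2, a3, a4, a5]"
    and inj: "inj_on p {a0, a1, a2, a3, a4, a5}"
    and sub: "{{a0, a1}, {a1, a2}, {a2, a3}, {a3, a4}, {a4, a5}, {a5, a0}} \<subseteq> T"
  shows "\<not> thrackle p T"
proof
  assume thr: "thrackle p T"
  have ne: "p x \<noteq> p y" if "x \<in> {a0, a1, a2, a3, a4, a5}" "y \<in> {a0, a1, a2, a3, a4, a5}" "x \<noteq> y"
    for x y
    using inj that by (meson inj_on_contraD)
  have cross: "\<exists>x. cross_properly_at p e f x" if "e \<in> T" "f \<in> T" "e \<inter> f = {}" "e \<noteq> {}" for e f
  proof -
    have "e \<noteq> f"
      using that by auto
    then obtain x where "x \<in> p ` (e \<inter> f) \<or> cross_properly_at p e f x"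
      using thr \<open>e \<in> T\<close> \<open>f \<in> T\<close> unfolding thrackle_def by meson
    with \<open>e \<inter> f = {}\<close> show ?thesis by blast
  qed
  let ?F = "side (p a0) (p a1)"
  have opp: "?F (p r) * ?F (p s) < 0"
    if rs: "{r, s} \<in> T" "r \<noteq> s" "r \<in> {a2, a3, a4, a5}" "s \<in> {a2, a3, a4, a5}" for r s
  proof -
    have "\<exists>x. cross_properly_at p {a0, a1} {r, s} x"
      using rs dist sub by (intro cross) auto
    then show ?thesis
      using opposite_sides_if_cross_properly[of p a0 a1 r s] ne[of a0 a1] ne[of r s] rs dist
      by auto
  qed
  have F: "?F (p a2) * ?F (p a3) < 0" "?F (p a3) * ?F (p a4) < 0" "?F (p a4) * ?F (p a5) < 0"
    using sub dist by (auto intro!: opp)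
  have "\<exists>x. cross_properly_at p {a1, a2} {a5, a0} x"
    using sub dist by (intro cross) auto
  then obtain x where "x \<in> open_segment (p a1) (p a2)" "x \<in> open_segment (p a0) (p a5)"
    using dist ne[of a1 a2] ne[of a5 a0]
    by (auto simp: cross_properly_at_def edge_segment_pair rel_interior_closed_segment
        open_segment_commute split: if_splits)
  then obtain s t where st: "0 < s" "0 < t" "x = (1 - s) *\<^sub>R p a1 + s *\<^sub>R p a2"
    "x = (1 - t) *\<^sub>R p a0 + t *\<^sub>R p a5"
    by (auto simp: in_segment)
  have "?F x = s * ?F (p a2)"
    unfolding st(3) side_affine by simp
  moreover have "?F x = t * ?F (p a5)"
    unfolding st(4) side_affine by simp
  ultimately have "s * ?F (p a2) = t * ?F (p a5)" by simp
  then have "?F (p a2) > 0 \<longleftrightarrow> ?F (p a5) > 0"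
    using st(1,2) by (metis zero_less_mult_pos zero_less_mult_iff mult_pos_pos)
  with F show False
    by (auto simp: mult_less_0_iff)
qed

section \<open>Edges of the subdivided complete graph\<close>

lemma subdivided_complete_edgesE:
  assumes "e \<in> edges (subdivision (complete_graph n))"
  obtains x i j where "i < j" "j < n" "x = i \<or> x = j" "e = {Inl x, Inr {i, j}}"
proof -
  obtain x S where S: "e = {Inl x, Inr S}" "S \<subseteq> {..<n}" "card S = 2" "x \<in> S"
    using assms by (auto simp: subdivision_def complete_graph_def)
  then obtain i j where ij: "S = {i, j}" "i \<noteq> j"
    by (auto simp: card_2_iff)
  show ?thesis
  proof (cases "i < j")
    case True
    then show ?thesis using that[of i j x] S ij by auto
  next
    case False
    then show ?thesis using that[of j i x] S ij by (auto simp: insert_commute)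
  qed
qed

lemma subdivided_complete_verticesE:
  assumes "u \<in> vertices (subdivision (complete_graph n))"
  obtains (Inl) x where "u = Inl x"
  | (Inr) i j where "i < j" "u = Inr {i, j}"
proof -
  consider x where "u = Inl x" | S where "u = Inr S" "card S = 2"
    using assms by (auto simp: subdivision_def complete_graph_def)
  then show ?thesis
  proof cases
    case 2
    then obtain i j where "S = {i, j}" "i \<noteq> j"
      by (auto simp: card_2_iff)
    then show ?thesis
      using Inr[of i j] Inr[of j i] 2 by (cases "i < j") (auto simp: insert_commute)
  qed (use Inl in auto)
qed

lemma finite_edges_subdivided_complete: "finite (edges (subdivision (complete_graph n)))"
proof -
  have fsg: "finite_simple_graph (subdivision (complete_graph n))"
    by (intro finite_simple_graph_subdivision finite_simple_graph_complete_graph)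
  then have "edges (subdivision (complete_graph n))
      \<subseteq> Pow (vertices (subdivision (complete_graph n)))"
    by (auto simp: finite_simple_graph_def)
  with fsg show ?thesis
    using finite_subset by (auto simp: finite_simple_graph_def)
qed

lemma not_thrackle_subdivided_complete:
  assumes "n \<ge> 3" "geometric_drawing (subdivision (complete_graph n)) p"
  shows "\<not> thrackle p (edges (subdivision (complete_graph n)))"
proof -
  let ?G = "subdivision (complete_graph n)"
  have K: "0 \<in> vertices (complete_graph n)" "1 \<in> vertices (complete_graph n)"
    "2 \<in> vertices (complete_graph n)" "{0, 1} \<in> edges (complete_graph n)"
    "{1, 2} \<in> edges (complete_graph n)" "{0, 2} \<in> edges (complete_graph n)"
    using assms(1) by (simp_all add: complete_graph_def)
  have incident: "{Inl x, Inr S} \<in> edges ?G" "{Inr S, Inl x} \<in> edges ?G"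
    if "S \<in> edges (complete_graph n)" "x \<in> S" for x S
    using that unfolding subdivision_def snd_conv by blast+
  let ?V = "{Inl 0, Inr {0, 1}, Inl 1, Inr {1, 2}, Inl 2, Inr {0, 2}} :: (nat + nat set) set"
  have "distinct [Inl (0 :: nat), Inr {0, 1}, Inl 1, Inr {1, 2}, Inl 2, Inr {0, 2 :: nat}]"
    by (simp add: doubleton_eq_iff)
  moreover have "?V \<subseteq> vertices ?G"
    using K by (simp add: subdivision_def image_iff)
  then have "inj_on p ?V"
    using assms(2) inj_on_subset[of p "vertices ?G" ?V] by (simp only: geometric_drawing_def)
  moreover have "{{Inl 0, Inr {0, 1}}, {Inr {0, 1}, Inl 1}, {Inl 1, Inr {1, 2}}, {Inr {1, 2}, Inl 2},
      {Inl 2, Inr {0, 2}}, {Inr {0, 2}, Inl 0}} \<subseteq> edges ?G"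
    using K(4-6) incident by simp
  ultimately show ?thesis
    by (rule hexagon_not_thrackle)
qed

section \<open>The drawing\<close>

text \<open>The constant \<open>2\<close> only keeps the division vertices above the horizontal axis: adding the
  same amount to all values does not affect the differences on which the crossings depend.\<close>

definition recip_height :: "nat \<Rightarrow> real" where
  "recip_height j = 2 - (1/2) ^ j"

definition original_point :: "nat \<Rightarrow> plane" where
  "original_point x = (4 ^ x, 0)"

definition division_point :: "nat \<Rightarrow> nat \<Rightarrow> plane" where
  "division_point i j = (- (2 ^ i) / recip_height j, 1 / recip_height j)"

text \<open>With \<open>F i j t = - 2 ^ i - recip_height j * t\<close>, this is \<open>F i j t - F k l t\<close> at
  \<open>t = 4 ^ x\<close>, the position of the original vertex \<open>x\<close>.\<close>

definition gap :: "nat \<Rightarrow> nat \<Rightarrow> nat \<Rightarrow> nat \<Rightarrow> nat \<Rightarrow> real" where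
  "gap i j k l x = 2 ^ k - 2 ^ i + ((1/2) ^ j - (1/2) ^ l) * 4 ^ x"

definition subdivision_drawing :: "nat + nat set \<Rightarrow> plane" where
  "subdivision_drawing = case_sum original_point (\<lambda>S. division_point (Min S) (Max S))"

lemma subdivision_drawing_simps [simp]:
  "subdivision_drawing (Inl x) = original_point x"
  "i < j \<Longrightarrow> subdivision_drawing (Inr {i, j}) = division_point i j"
  by (simp_all add: subdivision_drawing_def)

lemma recip_height_pos [simp]: "recip_height j > 0" "recip_height j \<noteq> 0"
proof -
  have "(1/2 :: real) ^ j \<le> 1"
    by (simp add: power_le_one)
  then show "recip_height j > 0" by (simp add: recip_height_def)
  then show "recip_height j \<noteq> 0" by simp
qed

lemma side_division_point:
  "side (original_point x) (division_point i j) (division_point k l)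
     = gap i j k l x / (recip_height j * recip_height l)"
proof -
  have "side (original_point x) (division_point i j) (division_point k l)
     = (2 ^ k - 2 ^ i + (recip_height l - recip_height j) * 4 ^ x)
         / (recip_height j * recip_height l)"
    by (simp add: side_def original_point_def division_point_def field_simps)
  then show ?thesis
    by (simp add: gap_def recip_height_def)
qed

lemma side_original_point:
  "side (original_point x) (division_point i j) (original_point y)
     = (4 ^ x - 4 ^ y) / recip_height j"
  by (simp add: side_def original_point_def division_point_def field_simps)

lemma gap_swap: "gap k l i j x = - gap i j k l x"
  by (simp add: gap_def algebra_simps)

text \<open>Only the nested case \<open>l < j\<close> takes an estimate: there the negative part is less than
  \<open>2 ^ (-l) * 4 ^ x \<le> 2 ^ (k - 1)\<close> since \<open>x \<le> k < l\<close>, and the positive part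
  \<open>2 ^ k - 2 ^ i\<close> is at least \<open>2 ^ (k - 1)\<close>.\<close>

lemma gap_pos_if_mins_less:
  assumes "i < k" "k < l" "x \<le> k"
  shows "gap i j k l x > 0"
proof (cases "j \<le> l")
  case True
  then have "(1/2 :: real) ^ l \<le> (1/2) ^ j"
    by (intro power_decreasing) auto
  moreover have "(2 :: real) ^ i < 2 ^ k"
    using assms by simp
  ultimately show ?thesis
    unfolding gap_def by (simp add: add_pos_nonneg)
next
  case False
  have "(2 :: real) ^ Suc i \<le> 2 ^ k"
    using assms by (intro power_increasing) auto
  then have b: "(2 :: real) ^ i \<le> 2 ^ k / 2" by simp
  have "(1/2 :: real) ^ l * 4 ^ x \<le> (1/2) ^ Suc k * 4 ^ k"
    using assms by (intro mult_mono power_decreasing power_increasing) auto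
  also have "\<dots> = 2 ^ k / 2"
    by (simp add: power_mult_distrib[symmetric])
  finally have a: "(1/2 :: real) ^ l * 4 ^ x \<le> 2 ^ k / 2" .
  have "(1/2 :: real) ^ j * 4 ^ x > 0" by simp
  with a b show ?thesis
    unfolding gap_def left_diff_distrib by linarith
qed

text \<open>Here \<open>2 ^ (-j) - 2 ^ (-l)\<close> is at least \<open>2 ^ (-j - 1)\<close>, and multiplied by
  \<open>4 ^ x \<ge> 4 ^ j\<close> it yields at least \<open>2 ^ (j - 1) \<ge> 2 ^ i\<close>, which makes up for the term
  \<open>- 2 ^ i\<close> whatever the order of \<open>i\<close> and \<open>k\<close>; the term \<open>2 ^ k\<close> makes the sum
  positive.\<close>

lemma gap_pos_if_maxs_less:
  assumes "i < j" "j < l" "j \<le> x"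
  shows "gap i j k l x > 0"
proof -
  have "(1/2 :: real) ^ l \<le> (1/2) ^ Suc j"
    using assms by (intro power_decreasing) auto
  then have "(1/2 :: real) ^ Suc j \<le> (1/2) ^ j - (1/2) ^ l" by simp
  then have "(1/2 :: real) ^ Suc j * 4 ^ j \<le> ((1/2) ^ j - (1/2) ^ l) * 4 ^ x"
    using assms by (intro mult_mono power_increasing) (auto intro: order_trans[rotated])
  moreover have "(1/2 :: real) ^ Suc j * 4 ^ j = 2 ^ j / 2"
    by (simp add: power_mult_distrib[symmetric])
  moreover have "(2 :: real) ^ Suc i \<le> 2 ^ j"
    using assms by (intro power_increasing) auto
  moreover have "(2 :: real) ^ k > 0" by simp
  ultimately show ?thesis
    unfolding gap_def power_Suc by linarith
qed

lemma gap_nonzero: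
  assumes "i < j" "k < l" "x = i \<or> x = j" "(i, j) \<noteq> (k, l)"
  shows "gap i j k l x \<noteq> 0"
proof (cases "i = k \<or> j = l")
  case True
  have "(1/2 :: real) ^ j \<noteq> (1/2) ^ l" if "j \<noteq> l"
    using that by (simp add: power_one_over)
  with True show ?thesis
    using assms(4) by (auto simp: gap_def)
next
  case False
  from assms(3) show ?thesis
  proof
    assume "x = i"
    then show ?thesis
      using gap_pos_if_mins_less[of i k l x j] gap_pos_if_mins_less[of k i j x l] gap_swap[of k l i j x]
        False assms(1,2) by (cases "i < k") auto
  next
    assume "x = j"
    then show ?thesis
      using gap_pos_if_maxs_less[of i j l x k] gap_pos_if_maxs_less[of k l j x i] gap_swap[of k l i j x]
        False assms(1,2) by (cases "j < l") auto
  qed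
qed

text \<open>Even the line spanned by an edge contains no third vertex. This yields at once that no edge
  passes through a vertex, that no two edges are collinear, and that edges at a common original
  vertex meet only there.\<close>

lemma other_vertices_off_line:
  assumes "i < j" "x = i \<or> x = j"
    and "u \<in> vertices (subdivision (complete_graph n))" "u \<notin> {Inl x, Inr {i, j}}"
  shows "side (original_point x) (division_point i j) (subdivision_drawing u) \<noteq> 0"
  using assms(3)
proof (cases rule: subdivided_complete_verticesE)
  case (Inl y)
  with assms(4) have "(4 :: real) ^ x \<noteq> 4 ^ y" by simp
  with Inl show ?thesis by (simp add: side_original_point)
next
  case (Inr k l)
  with assms(4) have "(i, j) \<noteq> (k, l)" by auto
  with Inr assms(1,2) show ?thesis
    by (simp add: side_division_point gap_nonzero)
qed

lemma inj_on_subdivision_drawing: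
  "inj_on subdivision_drawing (vertices (subdivision (complete_graph n)))"
proof (rule inj_onI, rule ccontr)
  fix u v
  assume uv: "u \<in> vertices (subdivision (complete_graph n))"
    "v \<in> vertices (subdivision (complete_graph n))"
    "subdivision_drawing u = subdivision_drawing v" "u \<noteq> v"
  have *: False
    if "i < j" "u = Inr {i, j}" "u \<noteq> v" "subdivision_drawing u = subdivision_drawing v"
      "v \<in> vertices (subdivision (complete_graph n))" for i j u v
  proof (cases "v = Inl i")
    case True
    with that have "snd (division_point i j) = snd (original_point i)" by simp
    then show False by (simp add: division_point_def original_point_def)
  next
    case False
    then show False
      using other_vertices_off_line[of i j i v n] that
      by (metis insert_iff empty_iff side_endpoints(2) subdivision_drawing_simps(2))
  qed
  show False
    using uv(1)
  proof (cases rule: subdivided_complete_verticesE)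
    case (Inr i j)
    with * uv show False by blast
  next
    case x: (Inl x)
    show False
      using uv(2)
    proof (cases rule: subdivided_complete_verticesE)
      case (Inr i j)
      with * uv show False by metis
    next
      case (Inl y)
      with x uv show False by (simp add: original_point_def)
    qed
  qed
qed

lemma edges_not_collinear:
  assumes "e \<in> edges (subdivision (complete_graph n))" "f \<in> edges (subdivision (complete_graph n))"
    and "e \<noteq> f"
  shows "\<not> collinear (subdivision_drawing ` (e \<union> f))"
proof -
  obtain x i j where e: "i < j" "x = i \<or> x = j" "e = {Inl x, Inr {i, j}}"
    using assms(1) subdivided_complete_edgesE by metis
  have fsg: "finite_simple_graph (subdivision (complete_graph n))"
    by (intro finite_simple_graph_subdivision finite_simple_graph_complete_graph)
  then have "card e = 2" "card f = 2" "f \<subseteq> vertices (subdivision (complete_graph n))"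
    using assms unfolding finite_simple_graph_def by blast+
  moreover from this have "\<not> f \<subseteq> e"
    using assms(3) by (metis card_subset_eq card.infinite zero_neq_numeral)
  ultimately obtain u where u: "u \<in> f" "u \<notin> e" "u \<in> vertices (subdivision (complete_graph n))"
    by blast
  show ?thesis
  proof
    assume "collinear (subdivision_drawing ` (e \<union> f))"
    moreover have "subdivision_drawing (Inl x) \<in> subdivision_drawing ` (e \<union> f)"
      "subdivision_drawing (Inr {i, j}) \<in> subdivision_drawing ` (e \<union> f)"
      "subdivision_drawing u \<in> subdivision_drawing ` (e \<union> f)"
      using e u by blast+
    ultimately have "side (subdivision_drawing (Inl x)) (subdivision_drawing (Inr {i, j}))
        (subdivision_drawing u) = 0"
      by (rule collinear_imp_side_eq_0)
    then show False
      using other_vertices_off_line[of i j x u n] e u by simp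
  qed
qed

lemma geometric_drawing_subdivision_drawing:
  "geometric_drawing (subdivision (complete_graph n)) subdivision_drawing"
proof -
  have "subdivision_drawing v \<notin> edge_segment subdivision_drawing e"
    if e: "e \<in> edges (subdivision (complete_graph n))"
      and v: "v \<in> vertices (subdivision (complete_graph n))" "v \<notin> e" for e v
  proof -
    obtain x i j where "i < j" "x = i \<or> x = j" "e = {Inl x, Inr {i, j}}"
      using e subdivided_complete_edgesE by metis
    then show ?thesis
      using other_vertices_off_line[of i j x v n] v
        side_eq_0_on_segment[of "subdivision_drawing v" "original_point x" "division_point i j"]
      by (simp add: edge_segment_pair) blast
  qed
  then show ?thesis
    using inj_on_subdivision_drawing edges_not_collinear
    by (auto simp: geometric_drawing_def cross_properly_at_def)
qed

section \<open>The two thrackles\<close>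

text \<open>The original vertex \<open>y\<close> lies to the right of the line of the first edge because
  \<open>x < y\<close>, and the division vertex \<open>{k, l}\<close> to the left of it by the first inequality; likewise
  with the edges exchanged, by the second one.\<close>

lemma edges_cross_if_gaps_pos:
  assumes "i < j" "k < l" "x < y" "gap i j k l x > 0" "gap i j k l y > 0"
  shows "\<exists>z. edge_segment subdivision_drawing {Inl x, Inr {i, j}} \<inter>
               edge_segment subdivision_drawing {Inl y, Inr {k, l}} = {z} \<and>
             cross_properly_at subdivision_drawing {Inl x, Inr {i, j}} {Inl y, Inr {k, l}} z"
proof -
  let ?a = "original_point x" and ?b = "division_point i j"
  let ?c = "original_point y" and ?d = "division_point k l"
  have pow: "(4 :: real) ^ x < 4 ^ y"
    using assms by simp
  have abc: "side ?a ?b ?c < 0" and abd: "side ?a ?b ?d > 0"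
    and cda: "side ?c ?d ?a > 0" and cdb: "side ?c ?d ?b < 0"
    using assms pow gap_swap[of k l i j y]
    by (simp_all add: side_original_point side_division_point divide_neg_pos)
  obtain z where z: "closed_segment ?a ?b \<inter> closed_segment ?c ?d = {z}"
      "z \<in> open_segment ?a ?b" "z \<in> open_segment ?c ?d"
    using segments_cross_if_opposite_sides[of ?a ?b ?c ?d] mult_neg_pos[OF abc abd]
      mult_pos_neg[OF cda cdb] by blast
  have "\<not> collinear {?a, ?b, ?c, ?d}"
    using abc collinear_imp_side_eq_0[of "{?a, ?b, ?c, ?d}" ?a ?b ?c] by force
  moreover have "subdivision_drawing ` ({Inl x, Inr {i, j}} \<union> {Inl y, Inr {k, l}}) = {?a, ?b, ?c, ?d}"
    using assms(1,2) by (simp add: insert_commute)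
  moreover have "?a \<noteq> ?b" "?c \<noteq> ?d"
    using z(2,3) by (metis open_segment_idem empty_iff)+
  moreover have "edge_segment subdivision_drawing {Inl x, Inr {i, j}} = closed_segment ?a ?b"
    "edge_segment subdivision_drawing {Inl y, Inr {k, l}} = closed_segment ?c ?d"
    using assms by (simp_all add: edge_segment_pair)
  ultimately show ?thesis
    using z by (intro exI[of _ z]) (simp only: cross_properly_at_def rel_interior_closed_segment
        if_False simp_thms)
qed

lemma thrackle_if_gaps_pos:
  assumes sub: "T \<subseteq> edges (subdivision (complete_graph n))"
    and gaps: "\<And>x y i j k l. {Inl x, Inr {i, j}} \<in> T \<Longrightarrow> {Inl y, Inr {k, l}} \<in> T \<Longrightarrow>
      i < j \<Longrightarrow> k < l \<Longrightarrow> x < y \<Longrightarrow> gap i j k l x > 0 \<and> gap i j k l y > 0"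
  shows "thrackle subdivision_drawing T"
  unfolding thrackle_def
proof (intro ballI impI)
  fix e f assume ef: "e \<in> T" "f \<in> T" "e \<noteq> f"
  obtain x i j where e: "i < j" "x = i \<or> x = j" "e = {Inl x, Inr {i, j}}"
    by (rule subdivided_complete_edgesE[OF subsetD[OF sub ef(1)]])
  obtain y k l where f: "k < l" "y = k \<or> y = l" "f = {Inl y, Inr {k, l}}"
    by (rule subdivided_complete_edgesE[OF subsetD[OF sub ef(2)]])
  show "\<exists>z. edge_segment subdivision_drawing e \<inter> edge_segment subdivision_drawing f = {z} \<and>
      (z \<in> subdivision_drawing ` (e \<inter> f) \<or> cross_properly_at subdivision_drawing e f z)"
  proof (cases x y rule: linorder_cases)
    case less
    then have "gap i j k l x > 0" "gap i j k l y > 0"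
      using gaps[of x i j y k l] ef e f by simp_all
    then show ?thesis
      using edges_cross_if_gaps_pos[OF e(1) f(1) less] e f by auto
  next
    case greater
    then have "gap k l i j y > 0" "gap k l i j x > 0"
      using gaps[of y k l x i j] ef e f by simp_all
    then show ?thesis
      using edges_cross_if_gaps_pos[OF f(1) e(1) greater] e f
      by (auto simp: cross_properly_at_def Int_commute Un_commute)
  next
    case equal
    then have "(i, j) \<noteq> (k, l)"
      using ef e f by auto
    then have "side (original_point x) (division_point i j) (division_point k l) \<noteq> 0"
      using e f by (simp add: side_division_point gap_nonzero)
    from closed_segments_common_endpoint[OF this] show ?thesis
      using e f equal by (intro exI[of _ "original_point x"])
        (auto simp: edge_segment_pair intro!: image_eqI[of _ _ "Inl y"])
  qed
qed

definition min_max_colour :: "(nat + nat set) set \<Rightarrow> nat" where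
  "min_max_colour e = (if \<exists>S. Inr S \<in> e \<and> Inl (Min S) \<in> e then 0 else 1)"

lemma min_max_colour_less_2: "min_max_colour e < 2"
  by (simp add: min_max_colour_def)

lemma min_max_colour_edge:
  "i < j \<Longrightarrow> min_max_colour {Inl x, Inr {i, j}} = (if x = i then 0 else 1)"
  by (auto simp: min_max_colour_def)

lemma subdivided_complete_edge_incident:
  assumes "{Inl x, Inr {i, j}} \<in> edges (subdivision (complete_graph n))"
  shows "x = i \<or> x = j"
  using assms by (auto simp: subdivision_def doubleton_eq_iff)

lemma thrackle_min_max_colour:
  "thrackle subdivision_drawing
     {e \<in> edges (subdivision (complete_graph n)). min_max_colour e = c}"
proof (rule thrackle_if_gaps_pos[of _ n])
  fix x y i j k l :: nat
  assume in_T: "{Inl x, Inr {i, j}} \<in> {e \<in> edges (subdivision (complete_graph n)). min_max_colour e = c}"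
    "{Inl y, Inr {k, l}} \<in> {e \<in> edges (subdivision (complete_graph n)). min_max_colour e = c}"
    and *: "i < j" "k < l" "x < y"
  then have "x = i \<or> x = j" "y = k \<or> y = l" "x = i \<longleftrightarrow> y = k"
    using subdivided_complete_edge_incident by (auto simp: min_max_colour_edge split: if_splits)
  then consider "x = i" "y = k" | "x = j" "y = l" by blast
  then show "gap i j k l x > 0 \<and> gap i j k l y > 0"
    using * gap_pos_if_mins_less gap_pos_if_maxs_less by cases auto
qed (rule Collect_subset)

section \<open>The antithickness\<close>

text \<open>Giving every edge a colour of its own shows that the minimum is taken over a nonempty
  set.\<close>

lemma drawing_antithickness_attained:
  assumes "finite (edges G)"
  shows "drawing_antithickness G p > 0 \<and>
    (\<exists>c. (\<forall>e \<in> edges G. c e < drawing_antithickness G p) \<and>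
         (\<forall>i < drawing_antithickness G p. thrackle p {e \<in> edges G. c e = i}))"
proof -
  obtain c :: "'a set \<Rightarrow> nat" where inj: "inj_on c (edges G)"
    using finite_imp_inj_to_nat_seg[OF assms] by blast
  let ?k = "Suc (Max (c ` edges G))"
  have "\<forall>e \<in> edges G. c e < ?k"
    using assms by (simp add: less_Suc_eq_le)
  moreover have "\<forall>i < ?k. thrackle p {e \<in> edges G. c e = i}"
    using inj by (auto simp: thrackle_def inj_on_def)
  ultimately have "\<exists>k :: nat. k > 0 \<and> (\<exists>c. (\<forall>e \<in> edges G. c e < k) \<and>
      (\<forall>i < k. thrackle p {e \<in> edges G. c e = i}))"
    by (intro exI[of _ ?k] exI[of _ c] conjI zero_less_Suc) assumption+
  then show ?thesis
    unfolding drawing_antithickness_def by (rule LeastI_ex)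
qed

lemma drawing_antithickness_neq_1:
  assumes "finite (edges G)" "\<not> thrackle p (edges G)"
  shows "drawing_antithickness G p \<noteq> 1"
proof
  assume "drawing_antithickness G p = 1"
  then obtain c where c: "\<forall>e \<in> edges G. c e < (1::nat)" "\<forall>i < (1::nat). thrackle p {e \<in> edges G. c e = i}"
    using drawing_antithickness_attained[OF assms(1), of p] by auto
  then have "{e \<in> edges G. c e = 0} = edges G" by auto
  with c(2) assms(2) show False by (metis zero_less_one)
qed

theorem lemma17:
  fixes n :: nat
  assumes "n \<ge> 3"
  shows "geometric_antithickness (subdivision (complete_graph n)) = 2"
proof -
  let ?G = "subdivision (complete_graph n)"
  have neq_1: "drawing_antithickness ?G p \<noteq> 1" if "geometric_drawing ?G p" for p
    using drawing_antithickness_neq_1 finite_edges_subdivided_complete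
      not_thrackle_subdivided_complete assms that by blast
  have "2 > (0::nat) \<and> (\<exists>c. (\<forall>e \<in> edges ?G. c e < (2::nat)) \<and>
      (\<forall>i < 2. thrackle subdivision_drawing {e \<in> edges ?G. c e = i}))"
    using thrackle_min_max_colour min_max_colour_less_2
    by (intro conjI exI[of _ min_max_colour] ballI allI impI) simp_all
  then have "drawing_antithickness ?G subdivision_drawing \<le> 2"
    unfolding drawing_antithickness_def by (rule Least_le)
  moreover have "drawing_antithickness ?G subdivision_drawing > 0"
    using drawing_antithickness_attained[OF finite_edges_subdivided_complete] by blast
  ultimately have eq_2: "drawing_antithickness ?G subdivision_drawing = 2"
    using neq_1[OF geometric_drawing_subdivision_drawing] by linarith
  show ?thesis
    unfolding geometric_antithickness_def
  proof (rule Least_equality)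
    show "2 > (0::nat) \<and> (\<exists>p. geometric_drawing ?G p \<and> drawing_antithickness ?G p = 2)"
      using eq_2 geometric_drawing_subdivision_drawing by auto
  next
    fix k assume "k > 0 \<and> (\<exists>p. geometric_drawing ?G p \<and> drawing_antithickness ?G p = k)"
    then show "2 \<le> k"
      using neq_1 by (metis One_nat_def Suc_1 Suc_leI le_neq_implies_less)
  qed
qed

end
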